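(* Let $(A,\cdot)$ be an anti-pre-Lie algebra and $(V,\rho,\mu)$ a representation of $(A,\cdot)$. Define $\rho^*,\mu^*:A\to\mathfrak{gl}(V^* )$ by $\langle\rho^*(x)(\xi),u\rangle=-\langle\xi,\rho(x)(u)\rangle$ and $\langle\mu^*(x)(\xi),u\rangle=-\langle\xi,\mu(x)(u)\rangle$ for all $x\in A$, $u\in V$, $\xi\in V^*$. Then $(V^*,\mu^*-\rho^*,\mu^* )$ is a representation of $(A,\cdot)$.
   Context: All vector spaces are over a field $\mathbb K$. An anti-pre-Lie algebra is a vector space $A$ with a bilinear product $\cdot$ such that for all $x,y,z\in A$, with $[x,y]=x\cdot y-y\cdot x$: (1) $x\cdot(y\cdot z)-y\cdot(x\cdot z)=[y,x]\cdot z$; (2) $[x,y]\cdot z+[y,z]\cdot x+[z,x]\cdot y=0$. A representation of $(A,\cdot)$ on a vector space $V$, written $(V,\rho,\mu)$, is a pair of linear maps $\rho,\mu:A\to\mathfrak{gl}(V)$ such that for all $x,y\in A$: $\rho(x)\rho(y)-\rho(y)\rho(x)=\rho([y,x])$; $\mu(x\cdot y)-\rho(x)\mu(y)=\mu(y)\rho(x)-\mu(y)\mu(x)$; $\mu(y)\mu(x)-\mu(x)\mu(y)+\rho([x,y])=\mu(y)\rho(x)-\mu(x)\rho(y)$. $V^*$ is the linear dual of $V$ and $\langle\cdot,\cdot\rangle$ the evaluation pairing. *)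

theory Defs
  imports "HOL-Algebra.Module"
begin

locale vectorspace = K?: field K + V?: module K V
  for K (structure) and V (structure)

definition linear_maps ::
  "('k, 'm) ring_scheme \<Rightarrow> ('k, 'v, 'n) module_scheme \<Rightarrow> ('k, 'w, 'p) module_scheme \<Rightarrow> ('v \<Rightarrow> 'w) set"
  where "linear_maps K V W =
    {f \<in> carrier V \<rightarrow> carrier W.
       (\<forall>u \<in> carrier V. \<forall>v \<in> carrier V. f (u \<oplus>\<^bsub>V\<^esub> v) = f u \<oplus>\<^bsub>W\<^esub> f v) \<and>
       (\<forall>a \<in> carrier K. \<forall>u \<in> carrier V. f (a \<odot>\<^bsub>V\<^esub> u) = a \<odot>\<^bsub>W\<^esub> f u)}"

text \<open>
  The vector space of linear maps from \<open>V\<close> to \<open>W\<close>. Its elements are taken extensional, i.e. equal to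
  \<^const>\<open>undefined\<close> off \<^term>\<open>carrier V\<close>, so that two of them are equal iff they agree on
  \<^term>\<open>carrier V\<close>. The multiplicative fields of the record carry no meaning.
\<close>
definition hom_space ::
  "('k, 'm) ring_scheme \<Rightarrow> ('k, 'v, 'n) module_scheme \<Rightarrow> ('k, 'w, 'p) module_scheme
     \<Rightarrow> ('k, 'v \<Rightarrow> 'w) module"
  where "hom_space K V W =
    \<lparr>carrier = linear_maps K V W \<inter> extensional (carrier V),
     mult = undefined,
     one = undefined,
     zero = (\<lambda>u \<in> carrier V. \<zero>\<^bsub>W\<^esub>),
     add = (\<lambda>f g. \<lambda>u \<in> carrier V. f u \<oplus>\<^bsub>W\<^esub> g u),
     smult = (\<lambda>a f. \<lambda>u \<in> carrier V. a \<odot>\<^bsub>W\<^esub> f u)\<rparr>"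

text \<open>
  The vector space of endomorphisms of \<open>V\<close>, with composition as the product; the Lie bracket of
  \<open>\<gg>\<ll>(V)\<close> is the commutator of this product.
\<close>
definition gl ::
  "('k, 'm) ring_scheme \<Rightarrow> ('k, 'v, 'n) module_scheme \<Rightarrow> ('k, 'v \<Rightarrow> 'v) module"
  where "gl K V =
    (hom_space K V V)\<lparr>mult := compose (carrier V), one := (\<lambda>u \<in> carrier V. u)\<rparr>"

definition ground_space :: "('k, 'm) ring_scheme \<Rightarrow> ('k, 'k) module"
  where "ground_space K =
    \<lparr>carrier = carrier K, mult = mult K, one = one K, zero = zero K, add = add K, smult = mult K\<rparr>"

definition dual_space ::
  "('k, 'm) ring_scheme \<Rightarrow> ('k, 'v, 'n) module_scheme \<Rightarrow> ('k, 'v \<Rightarrow> 'k) module"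
  where "dual_space K V = hom_space K V (ground_space K)"

definition commutator :: "('k, 'a, 'm) module_scheme \<Rightarrow> 'a \<Rightarrow> 'a \<Rightarrow> 'a"
  where "commutator A x y = x \<otimes>\<^bsub>A\<^esub> y \<ominus>\<^bsub>A\<^esub> y \<otimes>\<^bsub>A\<^esub> x"

text \<open>
  The product of the algebra is the field \<^const>\<open>mult\<close> of the record \<open>A\<close>. The locale
  \<^locale>\<open>module\<close> does not constrain this field, and the field \<^const>\<open>one\<close> is not used.
\<close>
locale anti_pre_Lie_algebra = vectorspace K A
  for K (structure) and A (structure) +
  assumes mult_left_linear:
      "y \<in> carrier A \<Longrightarrow> (\<lambda>x. x \<otimes>\<^bsub>A\<^esub> y) \<in> linear_maps K A A"
    and mult_right_linear:
      "x \<in> carrier A \<Longrightarrow> (\<lambda>y. x \<otimes>\<^bsub>A\<^esub> y) \<in> linear_maps K A A"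
    and anti_pre_Lie:
      "\<lbrakk>x \<in> carrier A; y \<in> carrier A; z \<in> carrier A\<rbrakk> \<Longrightarrow>
        x \<otimes>\<^bsub>A\<^esub> (y \<otimes>\<^bsub>A\<^esub> z) \<ominus>\<^bsub>A\<^esub> y \<otimes>\<^bsub>A\<^esub> (x \<otimes>\<^bsub>A\<^esub> z)
          = commutator A y x \<otimes>\<^bsub>A\<^esub> z"
    and commutator_cyclic:
      "\<lbrakk>x \<in> carrier A; y \<in> carrier A; z \<in> carrier A\<rbrakk> \<Longrightarrow>
        commutator A x y \<otimes>\<^bsub>A\<^esub> z \<oplus>\<^bsub>A\<^esub> commutator A y z \<otimes>\<^bsub>A\<^esub> x
          \<oplus>\<^bsub>A\<^esub> commutator A z x \<otimes>\<^bsub>A\<^esub> y = \<zero>\<^bsub>A\<^esub>"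

locale anti_pre_Lie_representation = A?: anti_pre_Lie_algebra K A + V?: vectorspace K V
  for K (structure) and A (structure) and V (structure) and \<rho> and \<mu> +
  assumes rho_linear: "\<rho> \<in> linear_maps K A (gl K V)"
    and mu_linear: "\<mu> \<in> linear_maps K A (gl K V)"
    and rho_commutator:
      "\<lbrakk>x \<in> carrier A; y \<in> carrier A\<rbrakk> \<Longrightarrow>
        \<rho> x \<otimes>\<^bsub>gl K V\<^esub> \<rho> y \<ominus>\<^bsub>gl K V\<^esub> \<rho> y \<otimes>\<^bsub>gl K V\<^esub> \<rho> x = \<rho> (commutator A y x)"
    and mu_mult:
      "\<lbrakk>x \<in> carrier A; y \<in> carrier A\<rbrakk> \<Longrightarrow>
        \<mu> (x \<otimes>\<^bsub>A\<^esub> y) \<ominus>\<^bsub>gl K V\<^esub> \<rho> x \<otimes>\<^bsub>gl K V\<^esub> \<mu> y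
          = \<mu> y \<otimes>\<^bsub>gl K V\<^esub> \<rho> x \<ominus>\<^bsub>gl K V\<^esub> \<mu> y \<otimes>\<^bsub>gl K V\<^esub> \<mu> x"
    and mu_commutator:
      "\<lbrakk>x \<in> carrier A; y \<in> carrier A\<rbrakk> \<Longrightarrow>
        \<mu> y \<otimes>\<^bsub>gl K V\<^esub> \<mu> x \<ominus>\<^bsub>gl K V\<^esub> \<mu> x \<otimes>\<^bsub>gl K V\<^esub> \<mu> y \<oplus>\<^bsub>gl K V\<^esub> \<rho> (commutator A x y)
          = \<mu> y \<otimes>\<^bsub>gl K V\<^esub> \<rho> x \<ominus>\<^bsub>gl K V\<^esub> \<mu> x \<otimes>\<^bsub>gl K V\<^esub> \<rho> y"

definition dual_action ::
  "('k, 'm) ring_scheme \<Rightarrow> ('k, 'v, 'n) module_scheme \<Rightarrow> ('a \<Rightarrow> 'v \<Rightarrow> 'v)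
     \<Rightarrow> 'a \<Rightarrow> ('v \<Rightarrow> 'k) \<Rightarrow> ('v \<Rightarrow> 'k)"
  where "dual_action K V \<rho> x =
    (\<lambda>\<xi> \<in> carrier (dual_space K V). \<lambda>u \<in> carrier V. \<ominus>\<^bsub>K\<^esub> \<xi> (\<rho> x u))"

end

theory Submission
  imports Defs
begin

text \<open>The negative transpose T, which sends an endomorphism f of V to the map xi |-> -(xi o f)
  on the dual, moves the question into the associative ring gl(V). It is linear
  (\<open>neg_transpose_linear\<close>), and T(f) T(g) = T(-(g f)), since transposition reverses
  composition and two signs cancel (\<open>neg_transpose_mult\<close>). As mu* = T o mu and mu* -
  rho* = T o (mu - rho), both sides of every axiom for the dual are values of T, so it is enough to
  show that their arguments agree in gl(V).

  Write a, b for rho x, rho y; c, d for mu x, mu y; p, q for mu of the products xy, yx; and r for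
  rho [x,y]. The second dual axiom then says p = ad + da - dc, which is the second axiom for V.
  Substituting p and q, the third one becomes r = da - cb - dc + cd, the third axiom for V. In the
  first one, after the commutator ba - ab is replaced by r, the two sides differ by 2(da - cb - dc +
  cd) - 2r, which vanishes for the same reason. These computations are
  \<open>dual_identities\<close>; \<open>gl_ring\<close> makes them available in gl(V).\<close>

section \<open>Linear maps and the vector spaces they form\<close>

lemma linear_maps_closed:
  "f \<in> linear_maps K V W \<Longrightarrow> u \<in> carrier V \<Longrightarrow> f u \<in> carrier W"
  by (auto simp: linear_maps_def)

lemma linear_maps_add:
  "f \<in> linear_maps K V W \<Longrightarrow> u \<in> carrier V \<Longrightarrow> v \<in> carrier V \<Longrightarrow>
    f (u \<oplus>\<^bsub>V\<^esub> v) = f u \<oplus>\<^bsub>W\<^esub> f v"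
  by (auto simp: linear_maps_def)

lemma linear_maps_smult:
  "f \<in> linear_maps K V W \<Longrightarrow> a \<in> carrier K \<Longrightarrow> u \<in> carrier V \<Longrightarrow>
    f (a \<odot>\<^bsub>V\<^esub> u) = a \<odot>\<^bsub>W\<^esub> f u"
  by (auto simp: linear_maps_def)

lemma linear_mapsI:
  assumes "\<And>u. u \<in> carrier V \<Longrightarrow> f u \<in> carrier W"
    and "\<And>u v. u \<in> carrier V \<Longrightarrow> v \<in> carrier V \<Longrightarrow> f (u \<oplus>\<^bsub>V\<^esub> v) = f u \<oplus>\<^bsub>W\<^esub> f v"
    and "\<And>a u. a \<in> carrier K \<Longrightarrow> u \<in> carrier V \<Longrightarrow> f (a \<odot>\<^bsub>V\<^esub> u) = a \<odot>\<^bsub>W\<^esub> f u"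
  shows "f \<in> linear_maps K V W"
  using assms by (auto simp: linear_maps_def)

text \<open>Membership in \<open>linear_maps\<close> ignores values off the carrier. The dual action
  is identified with a value of the transpose only for x in the carrier of A, so its linearity has
  to be transferred in this form.\<close>

lemma linear_maps_cong:
  assumes "module K V" "f \<in> linear_maps K V W"
    and "\<And>u. u \<in> carrier V \<Longrightarrow> g u = f u"
  shows "g \<in> linear_maps K V W"
proof -
  interpret V: module K V by fact
  show ?thesis using assms(2,3) by (auto simp: linear_maps_def)
qed

text \<open>Additivity applied to u = (u - v) + v, followed by cancelling f v.\<close>

lemma linear_maps_minus:
  assumes "module K V" "module K W" and f: "f \<in> linear_maps K V W"
    and u: "u \<in> carrier V" and v: "v \<in> carrier V"
  shows "f (u \<ominus>\<^bsub>V\<^esub> v) = f u \<ominus>\<^bsub>W\<^esub> f v"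
proof -
  interpret V: module K V by fact
  interpret W: module K W by fact
  have "f u = f ((u \<ominus>\<^bsub>V\<^esub> v) \<oplus>\<^bsub>V\<^esub> v)"
    using u v by (simp add: V.minus_eq V.a_assoc V.l_neg)
  also have "\<dots> = f (u \<ominus>\<^bsub>V\<^esub> v) \<oplus>\<^bsub>W\<^esub> f v"
    using f u v by (intro linear_maps_add) auto
  finally show ?thesis
    using u v linear_maps_closed[OF f]
    by (simp add: W.minus_eq W.a_assoc W.r_neg)
qed

lemma carrier_hom_space:
  "carrier (hom_space K V W) = linear_maps K V W \<inter> extensional (carrier V)"
  and zero_hom_space: "\<zero>\<^bsub>hom_space K V W\<^esub> = (\<lambda>u \<in> carrier V. \<zero>\<^bsub>W\<^esub>)"
  and add_hom_space: "f \<oplus>\<^bsub>hom_space K V W\<^esub> g = (\<lambda>u \<in> carrier V. f u \<oplus>\<^bsub>W\<^esub> g u)"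
  and smult_hom_space: "a \<odot>\<^bsub>hom_space K V W\<^esub> f = (\<lambda>u \<in> carrier V. a \<odot>\<^bsub>W\<^esub> f u)"
  by (simp_all add: hom_space_def)

lemma hom_space_eqI:
  assumes "f \<in> carrier (hom_space K V W)" "g \<in> carrier (hom_space K V W)"
    and "\<And>u. u \<in> carrier V \<Longrightarrow> f u = g u"
  shows "f = g"
  using assms by (auto simp: carrier_hom_space intro: extensionalityI)

lemma restrict_in_hom_space:
  assumes "module K V" "f \<in> linear_maps K V W"
  shows "(\<lambda>u \<in> carrier V. f u) \<in> carrier (hom_space K V W)"
proof -
  interpret V: module K V by fact
  show ?thesis
    using assms(2) by (auto simp: carrier_hom_space linear_maps_def)
qed

lemma hom_space_module:
  assumes "module K V" "module K W"
  shows "module K (hom_space K V W)"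
proof -
  interpret V: module K V by fact
  interpret W: module K W by fact
  have lin: "f \<in> linear_maps K V W" if "f \<in> carrier (hom_space K V W)" for f
    using that by (simp add: carrier_hom_space)
  note linear = linear_maps_closed[OF lin] linear_maps_add[OF lin] linear_maps_smult[OF lin]
  have add_closed: "f \<oplus>\<^bsub>hom_space K V W\<^esub> g \<in> carrier (hom_space K V W)"
    if "f \<in> carrier (hom_space K V W)" "g \<in> carrier (hom_space K V W)" for f g
    unfolding add_hom_space using that assms(1)
    by (intro restrict_in_hom_space linear_mapsI)
      (simp_all add: linear W.a_ac W.smult_r_distr)
  have zero_closed: "\<zero>\<^bsub>hom_space K V W\<^esub> \<in> carrier (hom_space K V W)"
    unfolding zero_hom_space using assms(1)
    by (intro restrict_in_hom_space linear_mapsI) simp_all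
  have smult_closed: "a \<odot>\<^bsub>hom_space K V W\<^esub> f \<in> carrier (hom_space K V W)"
    if "a \<in> carrier K" "f \<in> carrier (hom_space K V W)" for a f
    unfolding smult_hom_space using that assms(1)
    by (intro restrict_in_hom_space linear_mapsI)
      (simp_all add: linear W.smult_r_distr W.smult_assoc1[symmetric] V.R.m_comm)
  \<comment> \<open>The pointwise negative will be the witness for the additive inverse;
    \<open>abelian_groupI\<close> asks only that some inverse exists.\<close>
  have neg_closed: "(\<lambda>u \<in> carrier V. \<ominus>\<^bsub>W\<^esub> f u) \<in> carrier (hom_space K V W)"
    if "f \<in> carrier (hom_space K V W)" for f
    using that assms(1)
    by (intro restrict_in_hom_space linear_mapsI)
      (simp_all add: linear W.minus_add W.smult_r_minus)
  show ?thesis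
  proof (rule moduleI)
    show "cring K" by (rule V.R.cring_axioms)
    show "abelian_group (hom_space K V W)"
    proof (rule abelian_groupI)
      show "\<exists>g \<in> carrier (hom_space K V W). g \<oplus>\<^bsub>hom_space K V W\<^esub> f = \<zero>\<^bsub>hom_space K V W\<^esub>"
        if "f \<in> carrier (hom_space K V W)" for f
        using neg_closed[OF that] that
        by (intro bexI[of _ "\<lambda>u \<in> carrier V. \<ominus>\<^bsub>W\<^esub> f u"])
          (auto simp: add_hom_space zero_hom_space linear W.l_neg)
    qed (intro hom_space_eqI[of _ K V W] add_closed zero_closed;
        simp add: linear add_hom_space zero_hom_space W.a_ac)+
  qed (intro hom_space_eqI[of _ K V W] add_closed smult_closed;
      simp add: linear add_hom_space smult_hom_space W.smult_r_distr W.smult_l_distr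
        W.smult_assoc1)+
qed

text \<open>Negation and subtraction are defined from the additive monoid alone, so this equality
  carries them over from \<open>hom_space\<close> to \<open>gl\<close>.\<close>

lemma add_monoid_gl: "add_monoid (gl K V) = add_monoid (hom_space K V V)"
  by (simp add: gl_def)

text \<open>Subtraction in a record goes through an abstractly chosen inverse, so its values cannot
  be read off by unfolding. They are found by evaluating d + g = f at u and cancelling in W.\<close>

lemma hom_space_minus:
  assumes "module K V" "module K W"
    and "f \<in> carrier (hom_space K V W)" "g \<in> carrier (hom_space K V W)"
  shows "f \<ominus>\<^bsub>hom_space K V W\<^esub> g = (\<lambda>u \<in> carrier V. f u \<ominus>\<^bsub>W\<^esub> g u)"
proof -
  interpret W: module K W by fact
  interpret H: module K "hom_space K V W" using assms by (intro hom_space_module)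
  let ?d = "f \<ominus>\<^bsub>hom_space K V W\<^esub> g"
  have d: "?d \<in> carrier (hom_space K V W)" using assms by simp
  have cl: "h u \<in> carrier W" if "h \<in> carrier (hom_space K V W)" "u \<in> carrier V" for h u
    using that by (auto simp: carrier_hom_space linear_maps_def)
  have sum: "?d \<oplus>\<^bsub>hom_space K V W\<^esub> g = f"
    using assms by (simp add: H.minus_eq H.a_assoc H.l_neg)
  have "?d u = f u \<ominus>\<^bsub>W\<^esub> g u" if u: "u \<in> carrier V" for u
  proof -
    have "f u = ?d u \<oplus>\<^bsub>W\<^esub> g u"
      using u fun_cong[OF sum, of u] by (simp add: add_hom_space)
    then show ?thesis
      using cl[OF d u] cl[OF assms(4) u] by (simp add: W.minus_eq W.a_assoc W.r_neg)
  qed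
  moreover have "?d \<in> extensional (carrier V)" using d by (simp add: carrier_hom_space)
  ultimately show ?thesis by (auto simp: fun_eq_iff extensional_def)
qed

lemma ground_space_module:
  assumes "cring K"
  shows "module K (ground_space K)"
proof -
  interpret K: cring K by fact
  show ?thesis
    by (rule moduleI)
      (auto intro!: abelian_groupI simp: ground_space_def K.cring_axioms K.a_ac K.m_ac
        K.l_distr K.r_distr intro: K.add.l_inv_ex)
qed

section \<open>Endomorphisms as a module and as a ring\<close>

lemma carrier_gl: "carrier (gl K V) = carrier (hom_space K V V)"
  and zero_gl: "\<zero>\<^bsub>gl K V\<^esub> = (\<lambda>u \<in> carrier V. \<zero>\<^bsub>V\<^esub>)"
  and add_gl: "f \<oplus>\<^bsub>gl K V\<^esub> g = (\<lambda>u \<in> carrier V. f u \<oplus>\<^bsub>V\<^esub> g u)"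
  and smult_gl: "a \<odot>\<^bsub>gl K V\<^esub> f = (\<lambda>u \<in> carrier V. a \<odot>\<^bsub>V\<^esub> f u)"
  and mult_gl: "f \<otimes>\<^bsub>gl K V\<^esub> g = compose (carrier V) f g"
  and one_gl: "\<one>\<^bsub>gl K V\<^esub> = (\<lambda>u \<in> carrier V. u)"
  by (simp_all add: gl_def hom_space_def)

lemma gl_module:
  assumes "module K V"
  shows "module K (gl K V)"
proof -
  interpret H: module K "hom_space K V V" using assms by (intro hom_space_module)
  show ?thesis
    by (rule moduleI)
      (use H.abelian_group_axioms H.module_axioms H.R.cring_axioms in
        \<open>auto simp: gl_def abelian_group_def abelian_monoid_def abelian_group_axioms_def
          module_def module_axioms_def\<close>)
qed

lemma gl_minus:
  assumes "module K V" "f \<in> carrier (gl K V)" "g \<in> carrier (gl K V)"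
  shows "f \<ominus>\<^bsub>gl K V\<^esub> g = (\<lambda>u \<in> carrier V. f u \<ominus>\<^bsub>V\<^esub> g u)"
proof -
  have "f \<ominus>\<^bsub>gl K V\<^esub> g = f \<ominus>\<^bsub>hom_space K V V\<^esub> g"
    unfolding a_minus_def a_inv_def add_monoid_gl by (simp add: gl_def)
  with assms show ?thesis by (simp add: hom_space_minus carrier_gl)
qed

text \<open>Provides the ring structure in which the representation axioms can be treated as
  noncommutative polynomial identities. One distributive law is pointwise; the other uses additivity
  of the outer map.\<close>

lemma gl_ring:
  assumes "module K V"
  shows "ring (gl K V)"
proof -
  interpret V: module K V by fact
  interpret G: module K "gl K V" using assms by (rule gl_module)
  have lin: "f \<in> linear_maps K V V" if "f \<in> carrier (gl K V)" for f
    using that by (simp add: carrier_gl carrier_hom_space)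
  have ext: "f \<in> extensional (carrier V)" if "f \<in> carrier (gl K V)" for f
    using that by (simp add: carrier_gl carrier_hom_space)
  note linear = linear_maps_closed[OF lin] linear_maps_add[OF lin] linear_maps_smult[OF lin]
  have mult_closed: "f \<otimes>\<^bsub>gl K V\<^esub> g \<in> carrier (gl K V)"
    if "f \<in> carrier (gl K V)" "g \<in> carrier (gl K V)" for f g
    unfolding mult_gl compose_def carrier_gl using that assms
    by (intro restrict_in_hom_space linear_mapsI) (simp_all add: linear)
  have one_closed: "\<one>\<^bsub>gl K V\<^esub> \<in> carrier (gl K V)"
    unfolding one_gl carrier_gl using assms by (intro restrict_in_hom_space linear_mapsI) simp_all
  have eqI: "f = g" if "f \<in> carrier (gl K V)" "g \<in> carrier (gl K V)"
    "\<And>u. u \<in> carrier V \<Longrightarrow> f u = g u" for f g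
    using that by (auto simp: carrier_gl intro: hom_space_eqI)
  show ?thesis
  proof (rule ringI)
    show "abelian_group (gl K V)" by (rule G.abelian_group_axioms)
    show "monoid (gl K V)"
      by (rule monoidI)
        (intro eqI mult_closed one_closed; simp add: mult_gl one_gl compose_def linear)+
  qed (intro eqI mult_closed G.a_closed; simp add: mult_gl add_gl compose_def linear)+
qed


section \<open>The negative transpose from gl(V) to gl of the dual\<close>

text \<open>
  The action dual to \<open>\<rho>\<close> depends on \<open>x\<close> only through \<open>\<rho> x\<close>, via a linear map that is, up to sign,
  anti-multiplicative. This turns the axioms for the dual into ring identities in \<open>\<gg>\<ll>(V)\<close>.
\<close>
definition neg_transpose ::
  "('k, 'm) ring_scheme \<Rightarrow> ('k, 'v, 'n) module_scheme \<Rightarrow> ('v \<Rightarrow> 'v) \<Rightarrow> ('v \<Rightarrow> 'k) \<Rightarrow> ('v \<Rightarrow> 'k)"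
  where "neg_transpose K V f =
    (\<lambda>\<xi> \<in> carrier (dual_space K V). \<lambda>u \<in> carrier V. \<ominus>\<^bsub>K\<^esub> \<xi> (f u))"

lemma dual_action_eq: "dual_action K V \<rho> x = neg_transpose K V (\<rho> x)"
  by (simp add: dual_action_def neg_transpose_def)

lemma dual_space_module: "module K V \<Longrightarrow> module K (dual_space K V)"
  unfolding dual_space_def
  by (intro hom_space_module ground_space_module) (auto simp: module_def)

lemma dual_space_simps:
  "\<xi> \<oplus>\<^bsub>dual_space K V\<^esub> \<eta> = (\<lambda>u \<in> carrier V. \<xi> u \<oplus>\<^bsub>K\<^esub> \<eta> u)"
  "a \<odot>\<^bsub>dual_space K V\<^esub> \<xi> = (\<lambda>u \<in> carrier V. a \<otimes>\<^bsub>K\<^esub> \<xi> u)"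
  by (simp_all add: dual_space_def hom_space_def ground_space_def)

lemma dual_space_apply:
  assumes "\<xi> \<in> carrier (dual_space K V)"
  shows "u \<in> carrier V \<Longrightarrow> \<xi> u \<in> carrier K"
    and "u \<in> carrier V \<Longrightarrow> v \<in> carrier V \<Longrightarrow> \<xi> (u \<oplus>\<^bsub>V\<^esub> v) = \<xi> u \<oplus>\<^bsub>K\<^esub> \<xi> v"
    and "a \<in> carrier K \<Longrightarrow> u \<in> carrier V \<Longrightarrow> \<xi> (a \<odot>\<^bsub>V\<^esub> u) = a \<otimes>\<^bsub>K\<^esub> \<xi> u"
  using assms by (auto simp: dual_space_def hom_space_def ground_space_def linear_maps_def)

lemma gl_apply:
  assumes "f \<in> carrier (gl K V)"
  shows "u \<in> carrier V \<Longrightarrow> f u \<in> carrier V"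
    and "u \<in> carrier V \<Longrightarrow> v \<in> carrier V \<Longrightarrow> f (u \<oplus>\<^bsub>V\<^esub> v) = f u \<oplus>\<^bsub>V\<^esub> f v"
    and "a \<in> carrier K \<Longrightarrow> u \<in> carrier V \<Longrightarrow> f (a \<odot>\<^bsub>V\<^esub> u) = a \<odot>\<^bsub>V\<^esub> f u"
  using assms by (auto simp: carrier_gl carrier_hom_space linear_maps_def)

lemma neg_transpose_apply_closed:
  assumes "module K V" and f: "f \<in> carrier (gl K V)" and \<xi>: "\<xi> \<in> carrier (dual_space K V)"
  shows "(\<lambda>u \<in> carrier V. \<ominus>\<^bsub>K\<^esub> \<xi> (f u)) \<in> carrier (dual_space K V)"
proof -
  interpret V: module K V by fact
  show ?thesis
    unfolding dual_space_def using assms(1)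
    by (intro restrict_in_hom_space linear_mapsI)
      (simp_all add: ground_space_def dual_space_apply[OF \<xi>] gl_apply[OF f] V.R.minus_add
        V.R.r_minus)
qed

lemma neg_transpose_closed:
  assumes "module K V" and f: "f \<in> carrier (gl K V)"
  shows "neg_transpose K V f \<in> carrier (gl K (dual_space K V))"
proof -
  interpret V: module K V by fact
  interpret D: module K "dual_space K V" using assms(1) by (rule dual_space_module)
  note closed = neg_transpose_apply_closed[OF assms]
  \<comment> \<open>Closure of the dual under its operations, restated in the unfolded form to which
    \<open>dual_space_simps\<close> rewrites them.\<close>
  have [simp]: "(\<lambda>u \<in> carrier V. \<xi> u \<oplus>\<^bsub>K\<^esub> \<eta> u) \<in> carrier (dual_space K V)"
    if "\<xi> \<in> carrier (dual_space K V)" "\<eta> \<in> carrier (dual_space K V)" for \<xi> \<eta>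
    using D.a_closed[OF that] by (simp add: dual_space_simps)
  have [simp]: "(\<lambda>u \<in> carrier V. a \<otimes>\<^bsub>K\<^esub> \<xi> u) \<in> carrier (dual_space K V)"
    if "a \<in> carrier K" "\<xi> \<in> carrier (dual_space K V)" for a \<xi>
    using D.smult_closed[OF that] by (simp add: dual_space_simps)
  show ?thesis
    unfolding neg_transpose_def carrier_gl
    using D.module_axioms closed
    by (intro restrict_in_hom_space linear_mapsI)
      (auto simp: dual_space_simps dual_space_apply gl_apply[OF f] V.R.minus_add V.R.r_minus
        fun_eq_iff restrict_def)
qed

lemma neg_transpose_add:
  assumes "module K V" and f: "f \<in> carrier (gl K V)" and g: "g \<in> carrier (gl K V)"
  shows "neg_transpose K V (f \<oplus>\<^bsub>gl K V\<^esub> g)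
    = neg_transpose K V f \<oplus>\<^bsub>gl K (dual_space K V)\<^esub> neg_transpose K V g"
proof -
  interpret V: module K V by fact
  show ?thesis
    by (auto simp: neg_transpose_def add_gl dual_space_simps dual_space_apply gl_apply[OF f]
        gl_apply[OF g] V.R.minus_add fun_eq_iff restrict_def)
qed

lemma neg_transpose_smult:
  assumes "module K V" and f: "f \<in> carrier (gl K V)" and a: "a \<in> carrier K"
  shows "neg_transpose K V (a \<odot>\<^bsub>gl K V\<^esub> f) = a \<odot>\<^bsub>gl K (dual_space K V)\<^esub> neg_transpose K V f"
proof -
  interpret V: module K V by fact
  show ?thesis
    using a by (auto simp: neg_transpose_def smult_gl dual_space_simps dual_space_apply
        gl_apply[OF f] V.R.r_minus fun_eq_iff restrict_def)
qed

lemma neg_transpose_linear: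
  "module K V \<Longrightarrow> neg_transpose K V \<in> linear_maps K (gl K V) (gl K (dual_space K V))"
  by (intro linear_mapsI neg_transpose_closed neg_transpose_add neg_transpose_smult)

lemma neg_transpose_minus:
  assumes "module K V" "f \<in> carrier (gl K V)" "g \<in> carrier (gl K V)"
  shows "neg_transpose K V (f \<ominus>\<^bsub>gl K V\<^esub> g)
    = neg_transpose K V f \<ominus>\<^bsub>gl K (dual_space K V)\<^esub> neg_transpose K V g"
  using assms
  by (intro linear_maps_minus[OF _ _ neg_transpose_linear] gl_module dual_space_module)

text \<open>Applied to xi, the left side is xi o g o f, as the signs of the two factors cancel. The
  single transpose on the right brings a sign of its own, which the inner minus compensates.\<close>

lemma neg_transpose_mult:
  assumes "module K V" and f: "f \<in> carrier (gl K V)" and g: "g \<in> carrier (gl K V)"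
  shows "neg_transpose K V f \<otimes>\<^bsub>gl K (dual_space K V)\<^esub> neg_transpose K V g
    = neg_transpose K V (\<ominus>\<^bsub>gl K V\<^esub> (g \<otimes>\<^bsub>gl K V\<^esub> f))"
proof -
  interpret V: module K V by fact
  interpret G: ring "gl K V" using assms(1) by (rule gl_ring)
  have gf: "g \<otimes>\<^bsub>gl K V\<^esub> f \<in> carrier (gl K V)" using f g by simp
  have neg: "\<ominus>\<^bsub>gl K V\<^esub> (g \<otimes>\<^bsub>gl K V\<^esub> f) = (\<lambda>u \<in> carrier V. \<ominus>\<^bsub>V\<^esub> g (f u))"
  proof -
    have "\<ominus>\<^bsub>gl K V\<^esub> (g \<otimes>\<^bsub>gl K V\<^esub> f) = \<zero>\<^bsub>gl K V\<^esub> \<ominus>\<^bsub>gl K V\<^esub> (g \<otimes>\<^bsub>gl K V\<^esub> f)"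
      using gf by (simp add: G.minus_eq)
    also have "\<dots> = (\<lambda>u \<in> carrier V. \<zero>\<^bsub>gl K V\<^esub> u \<ominus>\<^bsub>V\<^esub> (g \<otimes>\<^bsub>gl K V\<^esub> f) u)"
      using assms(1) gf by (intro gl_minus) simp_all
    finally show ?thesis
      by (auto simp: zero_gl mult_gl compose_def V.minus_eq gl_apply[OF f] gl_apply[OF g]
          fun_eq_iff restrict_def)
  qed
  \<comment> \<open>Homogeneity of xi for the scalar -1.\<close>
  have inv: "\<xi> (\<ominus>\<^bsub>V\<^esub> u) = \<ominus>\<^bsub>K\<^esub> \<xi> u"
    if \<xi>: "\<xi> \<in> carrier (dual_space K V)" and u: "u \<in> carrier V" for \<xi> u
    using dual_space_apply(3)[OF \<xi>, of "\<ominus>\<^bsub>K\<^esub> \<one>\<^bsub>K\<^esub>" u] u dual_space_apply(1)[OF \<xi> u]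
    by (simp add: V.smult_l_minus V.R.l_minus)
  show ?thesis
    using neg_transpose_apply_closed[OF assms(1) f] neg_transpose_apply_closed[OF assms(1) g]
    unfolding neg
    by (auto simp: neg_transpose_def mult_gl compose_def inv gl_apply[OF f]
        gl_apply[OF g] fun_eq_iff dual_space_apply)
qed

section \<open>The identities in an associative ring behind the dual axioms\<close>

text \<open>
  With \<open>a = \<rho> x\<close>, \<open>b = \<rho> y\<close>, \<open>c = \<mu> x\<close>, \<open>d = \<mu> y\<close>, \<open>p = \<mu> (x y)\<close>, \<open>q = \<mu> (y x)\<close> and
  \<open>r = \<rho> [x, y]\<close>, the conclusions are the transposed axioms of the dual representation.
\<close>
lemma (in ring) dual_identities:
  assumes carr: "a \<in> carrier R" "b \<in> carrier R" "c \<in> carrier R" "d \<in> carrier R"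
    "p \<in> carrier R" "q \<in> carrier R" "r \<in> carrier R"
    and ba: "b \<otimes> a \<ominus> a \<otimes> b = r"
    and p: "p \<ominus> a \<otimes> d = d \<otimes> a \<ominus> d \<otimes> c"
    and q: "q \<ominus> b \<otimes> c = c \<otimes> b \<ominus> c \<otimes> d"
    and r: "d \<otimes> c \<ominus> c \<otimes> d \<oplus> r = d \<otimes> a \<ominus> c \<otimes> b"
  shows "\<ominus> ((d \<ominus> b) \<otimes> (c \<ominus> a)) \<ominus> \<ominus> ((c \<ominus> a) \<otimes> (d \<ominus> b)) = (q \<ominus> p) \<ominus> (a \<otimes> b \<ominus> b \<otimes> a)"
    and "p \<ominus> \<ominus> (d \<otimes> (c \<ominus> a)) = \<ominus> ((c \<ominus> a) \<otimes> d) \<ominus> \<ominus> (c \<otimes> d)"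
    and "\<ominus> (c \<otimes> d) \<ominus> \<ominus> (d \<otimes> c) \<oplus> ((p \<ominus> q) \<ominus> r) = \<ominus> ((c \<ominus> a) \<otimes> d) \<ominus> \<ominus> ((d \<ominus> b) \<otimes> c)"
proof -
  \<comment> \<open>Solving the hypotheses for p, q and r turns them into polynomials in a, b, c, d,
    after which normalization in the free ring can decide the goals.\<close>
  have p': "p = a \<otimes> d \<oplus> d \<otimes> a \<ominus> d \<otimes> c"
  proof -
    have "p = (p \<ominus> a \<otimes> d) \<oplus> a \<otimes> d" using carr by algebra
    then show ?thesis unfolding p using carr by algebra
  qed
  have q': "q = b \<otimes> c \<oplus> c \<otimes> b \<ominus> c \<otimes> d"
  proof -
    have "q = (q \<ominus> b \<otimes> c) \<oplus> b \<otimes> c" using carr by algebra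
    then show ?thesis unfolding q using carr by algebra
  qed
  have r': "r = d \<otimes> a \<ominus> c \<otimes> b \<ominus> d \<otimes> c \<oplus> c \<otimes> d"
  proof -
    have "r = (d \<otimes> c \<ominus> c \<otimes> d \<oplus> r) \<ominus> d \<otimes> c \<oplus> c \<otimes> d" using carr by algebra
    then show ?thesis unfolding r using carr by algebra
  qed
  show "p \<ominus> \<ominus> (d \<otimes> (c \<ominus> a)) = \<ominus> ((c \<ominus> a) \<otimes> d) \<ominus> \<ominus> (c \<otimes> d)"
    unfolding p' using carr by algebra
  show "\<ominus> (c \<otimes> d) \<ominus> \<ominus> (d \<otimes> c) \<oplus> ((p \<ominus> q) \<ominus> r) = \<ominus> ((c \<ominus> a) \<otimes> d) \<ominus> \<ominus> ((d \<ominus> b) \<otimes> c)"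
    unfolding p' q' r' using carr by algebra
  \<comment> \<open>The relation \<open>ba\<close> does not eliminate a variable, so the commutator
    of b and a is first isolated on both sides and replaced by r. It enters with opposite signs,
    hence r = da - cb - dc + cd is used twice.\<close>
  have "\<ominus> ((d \<ominus> b) \<otimes> (c \<ominus> a)) \<ominus> \<ominus> ((c \<ominus> a) \<otimes> (d \<ominus> b))
    = c \<otimes> d \<ominus> d \<otimes> c \<oplus> d \<otimes> a \<ominus> c \<otimes> b \<oplus> b \<otimes> c \<ominus> a \<otimes> d \<ominus> (b \<otimes> a \<ominus> a \<otimes> b)"
    using carr by algebra
  moreover have "(q \<ominus> p) \<ominus> (a \<otimes> b \<ominus> b \<otimes> a) = (q \<ominus> p) \<oplus> (b \<otimes> a \<ominus> a \<otimes> b)"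
    using carr by algebra
  ultimately show "\<ominus> ((d \<ominus> b) \<otimes> (c \<ominus> a)) \<ominus> \<ominus> ((c \<ominus> a) \<otimes> (d \<ominus> b)) = (q \<ominus> p) \<ominus> (a \<otimes> b \<ominus> b \<otimes> a)"
    unfolding ba unfolding p' q' r' using carr by algebra
qed

section \<open>Assembling the dual representation\<close>

theorem theorem2p6:
  fixes K :: "('k, 'm) ring_scheme"
    and A :: "('k, 'a, 'n) module_scheme"
    and V :: "('k, 'v, 'p) module_scheme"
    and \<rho> \<mu> :: "'a \<Rightarrow> 'v \<Rightarrow> 'v"
  assumes "anti_pre_Lie_algebra K A"
    and "anti_pre_Lie_representation K A V \<rho> \<mu>"
  shows "anti_pre_Lie_representation K A (dual_space K V)
    (\<lambda>x. dual_action K V \<mu> x \<ominus>\<^bsub>gl K (dual_space K V)\<^esub> dual_action K V \<rho> x)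
    (dual_action K V \<mu>)"
proof -
  interpret rep: anti_pre_Lie_representation K A V \<rho> \<mu> by fact
  have V: "module K V" and A: "module K A" by unfold_locales
  interpret G: ring "gl K V" using V by (rule gl_ring)
  interpret GM: module K "gl K V" using V by (rule gl_module)
  interpret D: module K "dual_space K V" using V by (rule dual_space_module)
  let ?T = "neg_transpose K V" and ?G = "gl K V" and ?D = "gl K (dual_space K V)"
  have rho: "\<rho> x \<in> carrier ?G" and mu: "\<mu> x \<in> carrier ?G" if "x \<in> carrier A" for x
    using that rep.rho_linear rep.mu_linear by (auto intro: linear_maps_closed)
  have mult: "x \<otimes>\<^bsub>A\<^esub> y \<in> carrier A" if "x \<in> carrier A" "y \<in> carrier A" for x y
    using linear_maps_closed[OF rep.A.mult_right_linear] that by blast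
  then have comm: "commutator A x y \<in> carrier A" if "x \<in> carrier A" "y \<in> carrier A" for x y
    using that by (simp add: commutator_def)
  have mu_comm: "\<mu> (commutator A x y) = \<mu> (x \<otimes>\<^bsub>A\<^esub> y) \<ominus>\<^bsub>?G\<^esub> \<mu> (y \<otimes>\<^bsub>A\<^esub> x)"
    if "x \<in> carrier A" "y \<in> carrier A" for x y
    unfolding commutator_def using that mult
    by (intro linear_maps_minus[OF A gl_module[OF V] rep.mu_linear])
  have P: "dual_action K V \<mu> x \<ominus>\<^bsub>?D\<^esub> dual_action K V \<rho> x = ?T (\<mu> x \<ominus>\<^bsub>?G\<^esub> \<rho> x)"
    if "x \<in> carrier A" for x
    using that by (simp add: dual_action_eq neg_transpose_minus V rho mu)
  have T_diff: "?T f \<ominus>\<^bsub>?D\<^esub> ?T g = ?T (f \<ominus>\<^bsub>?G\<^esub> g)"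
    and T_sum: "?T f \<oplus>\<^bsub>?D\<^esub> ?T g = ?T (f \<oplus>\<^bsub>?G\<^esub> g)"
    if "f \<in> carrier ?G" "g \<in> carrier ?G" for f g
    using that by (simp_all add: neg_transpose_minus neg_transpose_add V)
  note T = P dual_action_eq neg_transpose_mult[OF V] T_diff T_sum rho mu mult comm
  note ids = G.dual_identities[of "\<rho> x" "\<rho> y" "\<mu> x" "\<mu> y" "\<mu> (x \<otimes>\<^bsub>A\<^esub> y)" "\<mu> (y \<otimes>\<^bsub>A\<^esub> x)"
      "\<rho> (commutator A x y)" for x y]
  \<comment> \<open>The \<open>rho_commutator\<close> instance for y, x supplies the hypothesis
    \<open>ba\<close>; the one for x, y turns ab - ba in the first conclusion into rho [y,x]. The
    \<open>mu_comm\<close> instances match the differences of p and q with mu of a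
    commutator.\<close>
  have id:
    "\<ominus>\<^bsub>?G\<^esub> ((\<mu> y \<ominus>\<^bsub>?G\<^esub> \<rho> y) \<otimes>\<^bsub>?G\<^esub> (\<mu> x \<ominus>\<^bsub>?G\<^esub> \<rho> x)) \<ominus>\<^bsub>?G\<^esub> \<ominus>\<^bsub>?G\<^esub> ((\<mu> x \<ominus>\<^bsub>?G\<^esub> \<rho> x) \<otimes>\<^bsub>?G\<^esub> (\<mu> y \<ominus>\<^bsub>?G\<^esub> \<rho> y))
      = \<mu> (commutator A y x) \<ominus>\<^bsub>?G\<^esub> \<rho> (commutator A y x)"
    "\<mu> (x \<otimes>\<^bsub>A\<^esub> y) \<ominus>\<^bsub>?G\<^esub> \<ominus>\<^bsub>?G\<^esub> (\<mu> y \<otimes>\<^bsub>?G\<^esub> (\<mu> x \<ominus>\<^bsub>?G\<^esub> \<rho> x))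
      = \<ominus>\<^bsub>?G\<^esub> ((\<mu> x \<ominus>\<^bsub>?G\<^esub> \<rho> x) \<otimes>\<^bsub>?G\<^esub> \<mu> y) \<ominus>\<^bsub>?G\<^esub> \<ominus>\<^bsub>?G\<^esub> (\<mu> x \<otimes>\<^bsub>?G\<^esub> \<mu> y)"
    "\<ominus>\<^bsub>?G\<^esub> (\<mu> x \<otimes>\<^bsub>?G\<^esub> \<mu> y) \<ominus>\<^bsub>?G\<^esub> \<ominus>\<^bsub>?G\<^esub> (\<mu> y \<otimes>\<^bsub>?G\<^esub> \<mu> x)
        \<oplus>\<^bsub>?G\<^esub> (\<mu> (commutator A x y) \<ominus>\<^bsub>?G\<^esub> \<rho> (commutator A x y))
      = \<ominus>\<^bsub>?G\<^esub> ((\<mu> x \<ominus>\<^bsub>?G\<^esub> \<rho> x) \<otimes>\<^bsub>?G\<^esub> \<mu> y) \<ominus>\<^bsub>?G\<^esub> \<ominus>\<^bsub>?G\<^esub> ((\<mu> y \<ominus>\<^bsub>?G\<^esub> \<rho> y) \<otimes>\<^bsub>?G\<^esub> \<mu> x)"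
    if x: "x \<in> carrier A" and y: "y \<in> carrier A" for x y
    using ids[of x y] rep.rho_commutator[OF y x] rep.rho_commutator[OF x y]
      rep.mu_mult[OF x y] rep.mu_mult[OF y x] rep.mu_commutator[OF x y]
      mu_comm[OF x y] mu_comm[OF y x] x y
    by (simp_all add: rho mu mult comm)
  have T_lin: "(\<lambda>x. ?T (f x)) \<in> linear_maps K A ?D" if f: "f \<in> linear_maps K A ?G" for f
    using linear_maps_closed[OF f] linear_maps_closed[OF neg_transpose_linear[OF V]]
      linear_maps_add[OF f] linear_maps_add[OF neg_transpose_linear[OF V]]
      linear_maps_smult[OF f] linear_maps_smult[OF neg_transpose_linear[OF V]]
    by (intro linear_mapsI) simp_all
  have diff_lin: "(\<lambda>x. \<mu> x \<ominus>\<^bsub>?G\<^esub> \<rho> x) \<in> linear_maps K A ?G"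
    using rho mu
    by (intro linear_mapsI)
      (simp_all add: linear_maps_add[OF rep.rho_linear] linear_maps_add[OF rep.mu_linear]
        linear_maps_smult[OF rep.rho_linear] linear_maps_smult[OF rep.mu_linear]
        G.minus_eq G.minus_add G.a_ac GM.smult_r_distr GM.smult_r_minus)
  have P_lin: "(\<lambda>x. dual_action K V \<mu> x \<ominus>\<^bsub>?D\<^esub> dual_action K V \<rho> x) \<in> linear_maps K A ?D"
    by (rule linear_maps_cong[OF A T_lin[OF diff_lin]]) (rule P)
  show ?thesis
  proof (intro anti_pre_Lie_representation.intro anti_pre_Lie_representation_axioms.intro)
    show "anti_pre_Lie_algebra K A" by fact
    show "vectorspace K (dual_space K V)"
      using rep.V.vectorspace_axioms D.module_axioms by (simp add: vectorspace_def)
    show "dual_action K V \<mu> \<in> linear_maps K A ?D"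
      using T_lin[OF rep.mu_linear] by (simp add: dual_action_eq[abs_def])
  \<comment> \<open>The rules \<open>T\<close> collapse each side of a remaining axiom to one value
    of the transpose, and \<open>id\<close> equates the arguments.\<close>
  qed (use P_lin in \<open>simp_all add: T id\<close>)
qed

end
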